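(* Let $r \ge 2$ be an integer and let $f_1,\ldots,f_r : \mathbb{Z}\to\mathbb{C}^*$ be group homomorphisms such that the partial products $g_i := \prod_{1\le j\le i} f_j$ satisfy $|g_i(1)|\le 1$ for all $1\le i\le r$, and assume $f_1(1)\neq 1$. Then for all $(s_1,\ldots,s_r)\in U_r$, $$f_1(1)\, L_{r-1}(g_2,f_3,\ldots,f_r;\ s_1+s_2,s_3,\ldots,s_r) + (f_1(1)-1)\, L_r(f_1,\ldots,f_r;\ s_1,\ldots,s_r) = \sum_{k\ge 0} (s_1)_k\, L_r(f_1,\ldots,f_r;\ s_1+k+1,s_2,\ldots,s_r),$$ where the series on the right hand side converges normally on every compact subset of $U_r$.
   Context: $U_r := \{ (s_1,\ldots,s_r) \in \mathbb{C}^r : \Re(s_1+\cdots+s_i) > i \text{ for all } 1 \le i \le r\}$. For additive characters $h_1,\ldots,h_d$ (group homomorphisms $\mathbb{Z}\to\mathbb{C}^*$) whose partial products $h_1\cdots h_i$ have absolute value at most $1$ at $1$, the multiple additive $L$-function is $$L_d(h_1,\ldots,h_d;\ s_1,\ldots,s_d) := \sum_{n_1>\cdots>n_d>0} \frac{h_1(n_1)\cdots h_d(n_d)}{n_1^{s_1}\cdots n_d^{s_d}},$$ which converges absolutely on $U_d$. For $s\in\mathbb{C}$ and integer $k\ge0$, $(s)_k := \frac{s(s+1)\cdots(s+k)}{(k+1)!}$. A series of functions converges normally on a set $X$ if the sum of the sup-norms over $X$ of its terms is finite. *)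

theory Defs
  imports "HOL-Analysis.Analysis"
begin

text \<open>
  An \<open>r\<close>-tuple over a type is a function on \<^typ>\<open>nat\<close> whose entries are those with index in
  \<open>{1..r}\<close>. Where sets of tuples matter (the summation range, the domain \<open>U r\<close> and its compact
  subsets), tuples are taken to be extensional, i.e. \<open>undefined\<close> outside \<open>{1..r}\<close>.
\<close>

text \<open>Group homomorphisms from the additive group of integers to the multiplicative group of
  nonzero complex numbers.\<close>
definition additive_character :: "(int \<Rightarrow> complex) \<Rightarrow> bool" where
  "additive_character h \<longleftrightarrow>
     (\<forall>n. h n \<noteq> 0) \<and> (\<forall>m n. h (m + n) = h m * h n)"

definition partial_prod :: "(nat \<Rightarrow> int \<Rightarrow> complex) \<Rightarrow> nat \<Rightarrow> int \<Rightarrow> complex" where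
  "partial_prod h i n = (\<Prod>j=1..i. h j n)"

text \<open>The product topology on \<open>r\<close> copies of the complex plane.\<close>
definition complex_space :: "nat \<Rightarrow> (nat \<Rightarrow> complex) topology" where
  "complex_space r = product_topology (\<lambda>_. euclidean) {1..r}"

definition U :: "nat \<Rightarrow> (nat \<Rightarrow> complex) set" where
  "U r = {s \<in> topspace (complex_space r). \<forall>i\<in>{1..r}. Re (\<Sum>j=1..i. s j) > real i}"

definition decreasing_tuples :: "nat \<Rightarrow> (nat \<Rightarrow> nat) set" where
  "decreasing_tuples d = {n \<in> {1..d} \<rightarrow>\<^sub>E {0<..}. strict_antimono_on {1..d} n}"

text \<open>The sum is unordered; for complex terms its convergence is absolute convergence.\<close>
definition multiple_L ::
    "nat \<Rightarrow> (nat \<Rightarrow> int \<Rightarrow> complex) \<Rightarrow> (nat \<Rightarrow> complex) \<Rightarrow> complex" where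
  "multiple_L d h s =
     (\<Sum>\<^sub>\<infinity>n\<in>decreasing_tuples d.
        (\<Prod>i=1..d. h i (int (n i))) / (\<Prod>i=1..d. of_nat (n i) powr s i))"

text \<open>Replaces the first two entries \<open>x\<^sub>1, x\<^sub>2\<close> of a tuple by the single entry \<open>y\<close>, giving
  \<open>(y, x\<^sub>3, x\<^sub>4, \<dots>)\<close>.\<close>
definition merge_first_two :: "'a \<Rightarrow> (nat \<Rightarrow> 'a) \<Rightarrow> nat \<Rightarrow> 'a" where
  "merge_first_two y x i = (if i = 1 then y else x (i + 1))"

text \<open>\<open>s (s + 1) \<cdots> (s + k) / (k + 1)!\<close>, with \<open>k + 1\<close> factors in the numerator.\<close>
definition translation_coeff :: "complex \<Rightarrow> nat \<Rightarrow> complex" where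
  "translation_coeff s k = pochhammer s (k + 1) / fact (k + 1)"

text \<open>The sup-norms are formed in \<^typ>\<open>ennreal\<close>, so an unbounded term has sup-norm \<open>\<infinity>\<close> and the
  supremum over the empty set is \<open>0\<close>.\<close>
definition normally_convergent_on :: "'a set \<Rightarrow> (nat \<Rightarrow> 'a \<Rightarrow> complex) \<Rightarrow> bool" where
  "normally_convergent_on X u \<longleftrightarrow> (\<Sum>k. SUP x\<in>X. ennreal (norm (u k x))) < \<infinity>"

end

theory Submission
  imports Defs
begin

text \<open>
  For \<open>N \<ge> 2\<close> the binomial series gives
  \<open>(N - 1) powr - s - N powr - s = (\<Sum>k. translation_coeff s k * N powr - (s + k + 1))\<close>.
  Apply this with \<open>N = n\<^sub>1\<close> and \<open>s = s\<^sub>1\<close>, multiply by the remaining factors of the summand of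
  \<open>L\<^sub>r\<close> and sum over \<open>n\<^sub>1 > \<dots> > n\<^sub>r > 0\<close>. On the left, the substitution \<open>n\<^sub>1 \<mapsto> n\<^sub>1 - 1\<close> pulls out
  \<open>f\<^sub>1(1)\<close> and turns the range into \<open>n\<^sub>1 \<ge> n\<^sub>2 > \<dots> > n\<^sub>r > 0\<close>, whose diagonal \<open>n\<^sub>1 = n\<^sub>2\<close>
  contributes \<open>L\<^sub>r\<^sub>-\<^sub>1\<close>.

  On a compact subset of \<open>U r\<close> there is \<open>\<delta> > 0\<close> with \<open>Re (s\<^sub>1 + \<dots> + s\<^sub>i) \<ge> i (1 + \<delta>)\<close> for all \<open>i\<close>.
  By partial summation in the exponents, every summand is then bounded by the product of the
  \<open>n\<^sub>i powr - (1 + \<delta>)\<close>, which is summable over all tuples of positive integers. This yields a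
  majorant of the double series in \<open>k\<close> and \<open>n\<close>, hence both the normal convergence and the
  interchange of the summations.
\<close>

section \<open>Summands, characters and decreasing tuples\<close>

definition L_term ::
    "nat \<Rightarrow> (nat \<Rightarrow> int \<Rightarrow> complex) \<Rightarrow> (nat \<Rightarrow> complex) \<Rightarrow> (nat \<Rightarrow> nat) \<Rightarrow> complex" where
  "L_term d h s n = (\<Prod>i=1..d. h i (int (n i))) / (\<Prod>i=1..d. of_nat (n i) powr s i)"

lemma multiple_L_eq: "multiple_L d h s = infsum (L_term d h s) (decreasing_tuples d)"
  unfolding multiple_L_def L_term_def ..

lemma additive_character_power:
  assumes "additive_character h"
  shows "h (int n) = h 1 ^ n"
proof (induction n)
  case 0
  have "h 0 * h 0 = h 0 * 1" "h 0 \<noteq> 0"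
    using assms unfolding additive_character_def by (metis add_0 mult.right_neutral, blast)
  then show ?case by simp
next
  case (Suc n)
  have "h (int n + 1) = h (int n) * h 1"
    using assms unfolding additive_character_def by blast
  then show ?case using Suc by (simp add: add.commute)
qed

lemma decreasing_tuples_pos: "n \<in> decreasing_tuples d \<Longrightarrow> i \<in> {1..d} \<Longrightarrow> n i > 0"
  by (auto simp: decreasing_tuples_def PiE_iff)

lemma decreasing_tuples_less:
  "n \<in> decreasing_tuples d \<Longrightarrow> i \<in> {1..d} \<Longrightarrow> j \<in> {1..d} \<Longrightarrow> i < j \<Longrightarrow> n j < n i"
  by (auto simp: decreasing_tuples_def monotone_on_def)

section \<open>Majorant of the summands\<close>

text \<open>Multiplicative partial summation: partial products of norm at most 1 allow their
  exponents to be lowered. Keeping the power \<open>n d\<close> on the right lets the induction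
  lower it to \<open>n (Suc d)\<close> and absorb the next factor.\<close>

lemma norm_prod_power_le:
  fixes c :: "nat \<Rightarrow> complex"
  assumes "\<And>i. i \<in> {1..d} \<Longrightarrow> norm (\<Prod>j=1..i. c j) \<le> 1"
    and "\<And>i. i \<in> {1..<d} \<Longrightarrow> n (Suc i) \<le> (n i :: nat)" and "d \<ge> 1"
  shows "norm (\<Prod>i=1..d. c i ^ n i) \<le> norm (\<Prod>i=1..d. c i) ^ n d"
  using \<open>d \<ge> 1\<close> assms(1,2)
proof (induction d rule: nat_induct_at_least)
  case base
  then show ?case by (simp add: norm_power)
next
  case (Suc d)
  have "norm (\<Prod>i=1..d. c i ^ n i) \<le> norm (\<Prod>i=1..d. c i) ^ n d"
    using Suc by auto
  also have "\<dots> \<le> norm (\<Prod>i=1..d. c i) ^ n (Suc d)"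
    using Suc.prems Suc.hyps by (intro power_decreasing) auto
  finally have "norm (\<Prod>i=1..d. c i ^ n i) * norm (c (Suc d)) ^ n (Suc d)
      \<le> norm (\<Prod>i=1..d. c i) ^ n (Suc d) * norm (c (Suc d)) ^ n (Suc d)"
    by (rule mult_right_mono) simp
  then show ?case
    by (simp add: norm_mult norm_power power_mult_distrib)
qed

text \<open>The base \<open>n d\<close> carrying the accumulated exponent is replaced by the smaller
  \<open>n (Suc d)\<close>; this can only lower the power, since that exponent is
  nonnegative.\<close>

lemma prod_powr_ge:
  fixes a :: "nat \<Rightarrow> real"
  assumes "\<And>i. i \<in> {1..d} \<Longrightarrow> (\<Sum>j=1..i. a j) \<ge> 0"
    and "\<And>i. i \<in> {1..<d} \<Longrightarrow> n (Suc i) \<le> (n i :: nat)"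
    and "\<And>i. i \<in> {1..d} \<Longrightarrow> n i > 0" and "d \<ge> 1"
  shows "(\<Prod>i=1..d. real (n i) powr a i) \<ge> real (n d) powr (\<Sum>i=1..d. a i)"
  using \<open>d \<ge> 1\<close> assms(1-3)
proof (induction d rule: nat_induct_at_least)
  case base
  then show ?case by simp
next
  case (Suc d)
  have "real (n (Suc d)) powr (\<Sum>i=1..d. a i) \<le> real (n d) powr (\<Sum>i=1..d. a i)"
    using Suc.prems Suc.hyps by (intro powr_mono2) auto
  also have "\<dots> \<le> (\<Prod>i=1..d. real (n i) powr a i)"
    using Suc by auto
  finally have "real (n (Suc d)) powr (\<Sum>i=1..d. a i) * real (n (Suc d)) powr a (Suc d)
      \<le> (\<Prod>i=1..d. real (n i) powr a i) * real (n (Suc d)) powr a (Suc d)"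
    by (rule mult_right_mono) simp
  then show ?case
    by (simp add: powr_add)
qed

text \<open>With \<open>a i = Re (s i) - (1 + \<delta>)\<close>, the product of the \<open>n i powr a i\<close> is at least \<open>1\<close>, because
  all partial sums of \<open>a\<close> are nonnegative and \<open>n\<close> decreases.\<close>
lemma norm_L_term_le:
  assumes "d \<ge> 1" and ch: "\<forall>i\<in>{1..d}. additive_character (h i)"
    and pp: "\<forall>i\<in>{1..d}. norm (partial_prod h i 1) \<le> 1"
    and s: "\<forall>i\<in>{1..d}. real i * (1 + \<delta>) \<le> Re (\<Sum>j=1..i. s j)"
    and n: "n \<in> decreasing_tuples d"
  shows "norm (L_term d h s n) \<le> (\<Prod>i=1..d. real (n i) powr - (1 + \<delta>))"
proof -
  have pos: "\<And>i. i \<in> {1..d} \<Longrightarrow> n i > 0"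
    and dec: "\<And>i. i \<in> {1..<d} \<Longrightarrow> n (Suc i) \<le> n i"
    using decreasing_tuples_pos[OF n] decreasing_tuples_less[OF n]
    by (auto simp: less_imp_le)
  have "norm (\<Prod>i=1..d. h i (int (n i))) = norm (\<Prod>i=1..d. h i 1 ^ n i)"
    using ch by (intro arg_cong[where f = norm] prod.cong) (auto simp: additive_character_power)
  also have "\<dots> \<le> norm (\<Prod>i=1..d. h i 1) ^ n d"
    using pp dec \<open>d \<ge> 1\<close> by (intro norm_prod_power_le) (auto simp: partial_prod_def)
  also have "\<dots> \<le> 1"
    using pp \<open>d \<ge> 1\<close> by (intro power_le_one) (auto simp: partial_prod_def)
  finally have num: "norm (\<Prod>i=1..d. h i (int (n i))) \<le> 1" .
  define a where "a i = Re (s i) - (1 + \<delta>)" for i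
  have a: "(\<Sum>j=1..i. a j) = Re (\<Sum>j=1..i. s j) - real i * (1 + \<delta>)" for i
    by (simp add: a_def sum_subtractf)
  have "1 \<le> real (n d) powr (\<Sum>i=1..d. a i)"
    using s pos[of d] \<open>d \<ge> 1\<close> unfolding a by (intro ge_one_powr_ge_zero) (auto simp del: Re_sum)
  also have "\<dots> \<le> (\<Prod>i=1..d. real (n i) powr a i)"
    using s pos dec \<open>d \<ge> 1\<close> by (intro prod_powr_ge) (auto simp only: a diff_ge_0_iff_ge)
  finally have ge1: "1 \<le> (\<Prod>i=1..d. real (n i) powr a i)" .
  have "norm (\<Prod>i=1..d. of_nat (n i) powr s i :: complex)
      = (\<Prod>i=1..d. real (n i) powr (1 + \<delta>) * real (n i) powr a i)"
    unfolding prod_norm[symmetric]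
    by (intro prod.cong refl) (simp add: norm_powr_real_powr powr_add[symmetric] a_def)
  also have "\<dots> = (\<Prod>i=1..d. real (n i) powr (1 + \<delta>)) * (\<Prod>i=1..d. real (n i) powr a i)"
    by (rule prod.distrib)
  also have "\<dots> \<ge> (\<Prod>i=1..d. real (n i) powr (1 + \<delta>)) * 1"
    using ge1 by (intro mult_left_mono prod_nonneg) auto
  finally have den: "(\<Prod>i=1..d. real (n i) powr (1 + \<delta>))
      \<le> norm (\<Prod>i=1..d. of_nat (n i) powr s i :: complex)" by simp
  have "(\<Prod>i=1..d. real (n i) powr (1 + \<delta>)) > 0"
    using pos by (intro prod_pos) simp
  then have "norm (L_term d h s n) \<le> 1 / (\<Prod>i=1..d. real (n i) powr (1 + \<delta>))"
    unfolding L_term_def norm_divide using num den by (intro frac_le) auto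
  also have "\<dots> = (\<Prod>i=1..d. real (n i) powr - (1 + \<delta>))"
    by (simp only: powr_minus prod_inversef[symmetric] inverse_eq_divide prod_dividef) simp
  finally show ?thesis .
qed

text \<open>Every finite set of tuples lies in a cube, over which the sum of products factors. So
  all finite sums are bounded by the \<open>d\<close>-th power of zeta(1 + \<delta>).\<close>

lemma summable_on_prod_powr:
  assumes "\<delta> > 0"
  shows "(\<lambda>n. \<Prod>i=1..d. real (n i) powr - (1 + \<delta>)) summable_on decreasing_tuples d"
proof (rule nonneg_bdd_above_summable_on)
  let ?g = "\<lambda>m::nat. real m powr - (1 + \<delta>)"
  have sm: "summable ?g"
    using summable_real_powr_iff[of "- (1 + \<delta>)"] assms by simp
  show "bdd_above (sum (\<lambda>n. \<Prod>i=1..d. ?g (n i)) ` {F. F \<subseteq> decreasing_tuples d \<and> finite F})"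
  proof (rule bdd_aboveI2)
    fix F assume "F \<in> {F. F \<subseteq> decreasing_tuples d \<and> finite F}"
    then have F: "F \<subseteq> decreasing_tuples d" "finite F" by auto
    \<comment> \<open>The inserted \<open>0\<close> keeps \<open>Max\<close> meaningful when there
      are no entries; \<open>Suc\<close> makes the bound strict.\<close>
    define N where "N = Suc (Max (insert 0 (\<Union>n\<in>F. n ` {1..d})))"
    have "n i < N" if "n \<in> F" "i \<in> {1..d}" for n i
    proof -
      have "n i \<in> (\<Union>n\<in>F. n ` {1..d})" using that by blast
      then show ?thesis
        unfolding N_def less_Suc_eq_le using F(2) by (intro Max_ge) auto
    qed
    then have "F \<subseteq> {1..d} \<rightarrow>\<^sub>E {..<N}"
      using F(1) by (auto simp: decreasing_tuples_def PiE_iff subset_iff)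
    then have "(\<Sum>n\<in>F. \<Prod>i=1..d. ?g (n i)) \<le> (\<Sum>n\<in>{1..d} \<rightarrow>\<^sub>E {..<N}. \<Prod>i=1..d. ?g (n i))"
      by (intro sum_mono2 finite_PiE prod_nonneg) auto
    also have "\<dots> = (\<Prod>i=1..d. \<Sum>m<N. ?g m)"
      by (subst prod_sum_PiE) auto
    also have "\<dots> \<le> (\<Prod>i=1..d. suminf ?g)"
      by (intro prod_mono conjI sum_nonneg sum_le_suminf[OF sm]) auto
    finally show "(\<Sum>n\<in>F. \<Prod>i=1..d. ?g (n i)) \<le> (\<Prod>i=1..d. suminf ?g)" .
  qed
qed (intro prod_nonneg, auto)

lemma summable_on_norm_le:
  fixes f :: "'a \<Rightarrow> 'b::banach"
  assumes "g summable_on A" "\<And>x. x \<in> A \<Longrightarrow> norm (f x) \<le> g x"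
  shows "f summable_on A"
  using Infinite_Sum.abs_summable_on_comparison_test'[OF assms] by (rule abs_summable_summable)

section \<open>Binomial series and translation coefficients\<close>

text \<open>The signs cancel in \<open>(- s gchoose m) * (- x) ^ m\<close>, leaving a Pochhammer
  quotient. Its term at \<open>m = 0\<close> is 1, whence the \<open>- 1\<close> and the shift to
  \<open>k + 1\<close>. The general field covers both the complex identity and its real
  majorant.\<close>

lemma gchoose_sums_shift:
  fixes s x y :: "'a::real_normed_field"
  assumes "(\<lambda>m. (- s gchoose m) * (- x) ^ m) sums y"
  shows "(\<lambda>k. pochhammer s (k + 1) / fact (k + 1) * x ^ (k + 1)) sums (y - 1)"
proof -
  have "(- s gchoose m) * (- x) ^ m = pochhammer s m / fact m * x ^ m" for m
  proof -
    have "(- 1) ^ m * (- x) ^ m = x ^ m"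
      by (simp add: power_mult_distrib[symmetric])
    then show ?thesis
      by (simp add: gbinomial_pochhammer mult_ac)
  qed
  with assms have "(\<lambda>m. pochhammer s m / fact m * x ^ m) sums y" by simp
  from sums_split_initial_segment[OF this, of 1] show ?thesis by simp
qed

lemma real_translation_sums:
  fixes M :: real
  assumes "N \<ge> (2::nat)"
  shows "(\<lambda>k. pochhammer M (k + 1) / fact (k + 1) * (1 / real N) ^ (k + 1)) sums
    ((1 - 1 / real N) powr (- M) - 1)"
  using gen_binomial_real[of "- (1 / real N)" "- M"] assms
  by (intro gchoose_sums_shift) simp

lemma complex_translation_sums:
  assumes "N \<ge> (2::nat)"
  shows "(\<lambda>k. translation_coeff s k * (1 / of_nat N) ^ (k + 1)) sums
    ((1 - 1 / of_nat N) powr (- s) - 1)"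
  using gen_binomial_complex[of "- (1 / of_nat N)" "- s"] assms
  unfolding translation_coeff_def by (intro gchoose_sums_shift) (simp add: norm_divide)

text \<open>Compare factor by factor. The bound is the same coefficient at the real point
  \<open>M\<close>, so the majorant is again summed by the binomial series.\<close>

lemma norm_translation_coeff_le:
  assumes "norm s \<le> M"
  shows "norm (translation_coeff s k) \<le> pochhammer M (k + 1) / fact (k + 1)"
proof -
  have "norm (pochhammer s (k + 1)) \<le> pochhammer M (k + 1)"
    unfolding pochhammer_prod prod_norm[symmetric]
  proof (intro prod_mono conjI norm_ge_zero)
    fix i show "norm (s + of_nat i) \<le> M + of_nat i"
      using norm_triangle_ineq[of s "of_nat i"] assms by simp
  qed
  then show ?thesis
    by (simp add: translation_coeff_def norm_divide divide_right_mono del: fact_Suc)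
qed

lemma L_term_shift:
  assumes "d \<ge> 1" "n 1 > 0"
  shows "L_term d h (s(1 := s 1 + of_nat k + 1)) n = L_term d h s n * (1 / of_nat (n 1)) ^ (k + 1)"
proof -
  have "{1..d} = insert 1 {2..d}" using \<open>d \<ge> 1\<close> by auto
  moreover have "(of_nat (n 1) :: complex) powr (s 1 + of_nat k + 1)
      = of_nat (n 1) powr s 1 * of_nat (n 1) ^ (k + 1)"
    using assms powr_nat'[of "of_nat (n 1)" "k + 1"]
    by (simp add: add.assoc powr_add)
  ultimately show ?thesis
    by (simp add: L_term_def power_one_over)
qed

section \<open>Uniform bounds on compact subsets\<close>

text \<open>The real part of each partial sum attains its minimum on a nonempty \<open>K\<close>,
  and this exceeds \<open>i\<close> as \<open>K\<close> lies in \<open>U r\<close>. Finitely many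
  indices permit a common \<delta>.\<close>

lemma compact_bounds:
  assumes K: "compactin (complex_space r) K" "K \<subseteq> U r" and r: "r \<ge> 1"
  shows "\<exists>\<delta> M. \<delta> > 0 \<and> M > 0 \<and> (\<forall>s\<in>K. norm (s 1) \<le> M \<and>
    (\<forall>i\<in>{1..r}. real i * (1 + \<delta>) \<le> Re (\<Sum>j=1..i. s j)))"
proof -
  have proj: "continuous_map (complex_space r) euclidean (\<lambda>s. s i)" if "i \<in> {1..r}" for i
    unfolding complex_space_def using that by (rule continuous_map_product_projection)
  have img: "compact (g ` K)" if "continuous_map (complex_space r) euclidean g"
    for g :: "(nat \<Rightarrow> complex) \<Rightarrow> complex"
    using image_compactin[OF K(1) that] by simp
  have "bounded ((\<lambda>s. s 1) ` K)"
    using img[OF proj[of 1]] r by (intro compact_imp_bounded) auto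
  then obtain M where M: "M > 0" "\<And>s. s \<in> K \<Longrightarrow> norm (s 1) \<le> M"
    unfolding bounded_pos by auto
  have "\<exists>\<delta>>0. \<forall>s\<in>K. real i * (1 + \<delta>) \<le> Re (\<Sum>j=1..i. s j)" if i: "i \<in> {1..r}" for i
  proof (cases "K = {}")
    case False
    let ?g = "\<lambda>s. \<Sum>j=1..i. (s j :: complex)"
    have g: "continuous_map (complex_space r) euclidean ?g"
      by (rule continuous_map_sum) (use i in \<open>auto intro: proj\<close>)
    have "compact (Re ` ?g ` K)"
      by (rule compact_continuous_image[OF _ img[OF g]]) (intro continuous_intros)
    then obtain s0 where s0: "s0 \<in> K" "\<And>s. s \<in> K \<Longrightarrow> Re (?g s0) \<le> Re (?g s)"
      using compact_attains_inf[of "Re ` ?g ` K"] False by auto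
    have "Re (?g s0) > real i"
      using s0(1) K(2) i unfolding U_def by blast
    \<comment> \<open>This choice makes \<open>real i * (1 + \<delta>)\<close> equal to the
      minimum.\<close>
    with i s0(2) show ?thesis
      by (intro exI[of _ "Re (?g s0) / real i - 1"]) (simp add: field_simps)
  qed (auto intro: exI[of _ 1])
  then obtain \<delta> where \<delta>: "\<And>i. i \<in> {1..r} \<Longrightarrow> \<delta> i > (0::real)"
    "\<And>i s. i \<in> {1..r} \<Longrightarrow> s \<in> K \<Longrightarrow> real i * (1 + \<delta> i) \<le> Re (\<Sum>j=1..i. s j)"
    by metis
  have "Min (\<delta> ` {1..r}) > 0"
    using r \<delta>(1) by (subst Min_gr_iff) auto
  moreover have "real i * (1 + Min (\<delta> ` {1..r})) \<le> Re (\<Sum>j=1..i. s j)"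
    if "i \<in> {1..r}" "s \<in> K" for i s
  proof -
    have "real i * (1 + Min (\<delta> ` {1..r})) \<le> real i * (1 + \<delta> i)"
      using that by (intro mult_left_mono add_left_mono Min_le) auto
    with \<delta>(2)[OF that] show ?thesis by linarith
  qed
  ultimately show ?thesis using M by blast
qed

section \<open>Diagonal tuples and the shift of the leading entry\<close>

text \<open>Isolates \<open>n 2 < n 1\<close>, the only ordering condition affected when
  \<open>n 1\<close> is shifted.\<close>

lemma decreasing_tuples_iff:
  assumes "r \<ge> 2"
  shows "n \<in> decreasing_tuples r \<longleftrightarrow>
    n \<in> {1..r} \<rightarrow>\<^sub>E {0<..} \<and> n 2 < n 1 \<and> strict_antimono_on {2..r} n"
proof -
  have "strict_antimono_on {1..r} n \<longleftrightarrow> n 2 < n 1 \<and> strict_antimono_on {2..r} n"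
  proof
    assume "n 2 < n 1 \<and> strict_antimono_on {2..r} n"
    then have *: "n 2 < n 1" "\<And>i j. i \<in> {2..r} \<Longrightarrow> j \<in> {2..r} \<Longrightarrow> i < j \<Longrightarrow> n j < n i"
      by (auto simp: monotone_on_def)
    have **: "n j < n 1" if "j \<in> {2..r}" for j
      using *(2)[of 2 j] *(1) that by (cases "j = 2") auto
    show "strict_antimono_on {1..r} n"
    proof (rule monotone_onI)
      fix i j assume "i \<in> {1..r}" "j \<in> {1..r}" "i < j"
      then show "n j < n i"
        using *(2)[of i j] **[of j] by (cases "i = 1") auto
    qed
  qed (use assms in \<open>auto simp: monotone_on_def\<close>)
  then show ?thesis by (auto simp: decreasing_tuples_def)
qed

text \<open>On the diagonal the first two factors share their argument m: f_1(m) f_2(m) = g_2(m),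
  and the exponents s_1, s_2 of m add up.\<close>

lemma L_term_merge:
  assumes "r \<ge> 2" "n 1 = n 2" "n 2 > 0"
  shows "L_term r f s n = L_term (r - 1) (merge_first_two (partial_prod f 2) f)
    (merge_first_two (s 1 + s 2) s) (\<lambda>i\<in>{1..r - 1}. n (i + 1))"
proof -
  obtain q where q: "r = Suc (Suc q)"
    using assms(1) by (metis Suc_le_D numeral_2_eq_2 Suc_le_mono)
  have split: "(\<Prod>i=1..r. g i) = g 1 * g 2 * (\<Prod>i=2..Suc q. g (Suc i))"
    "(\<Prod>i=1..r - 1. g i) = g 1 * (\<Prod>i=2..Suc q. g i)" for g :: "nat \<Rightarrow> complex"
  proof -
    have "{1..r} = insert 1 (insert 2 {3..Suc (Suc q)})" "{1..r-1} = insert 1 {2..Suc q}"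
      by (auto simp: q)
    moreover have "(\<Prod>i=3..Suc (Suc q). g i) = (\<Prod>i=2..Suc q. g (Suc i))"
      using prod.shift_bounds_cl_Suc_ivl[of g 2 "Suc q"] by (simp add: numeral_3_eq_3)
    ultimately show "(\<Prod>i=1..r. g i) = g 1 * g 2 * (\<Prod>i=2..Suc q. g (Suc i))"
      "(\<Prod>i=1..r - 1. g i) = g 1 * (\<Prod>i=2..Suc q. g i)" by (simp_all add: mult.assoc)
  qed
  have two: "Suc (Suc 0) = 2" by simp
  have pp: "partial_prod f 2 m = f 1 m * f 2 m" for m
    by (simp add: partial_prod_def numeral_2_eq_2)
  have "(\<Prod>i=2..Suc q. merge_first_two (partial_prod f 2) f i (int ((\<lambda>i\<in>{1..r - 1}. n (i + 1)) i)))
      = (\<Prod>i=2..Suc q. f (Suc i) (int (n (Suc i))))"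
    "(\<Prod>i=2..Suc q. of_nat ((\<lambda>i\<in>{1..r - 1}. n (i + 1)) i) powr merge_first_two (s 1 + s 2) s i)
      = (\<Prod>i=2..Suc q. of_nat (n (Suc i)) powr s (Suc i) :: complex)"
    by (auto intro!: prod.cong simp: merge_first_two_def q)
  then show ?thesis
    unfolding L_term_def split
    using assms by (simp add: merge_first_two_def q two pp powr_add)
qed

text \<open>Deleting the first entry of a diagonal tuple is a bijection onto the decreasing tuples
  of length \<open>r - 1\<close>; its inverse duplicates the first entry.\<close>

lemma infsum_merge:
  assumes "r \<ge> 2"
  shows "infsum (L_term r f s) {n \<in> {1..r} \<rightarrow>\<^sub>E {0<..}. n 1 = n 2 \<and> strict_antimono_on {2..r} n}
    = multiple_L (r - 1) (merge_first_two (partial_prod f 2) f) (merge_first_two (s 1 + s 2) s)"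
  unfolding multiple_L_eq
proof (rule infsum_reindex_bij_witness[where
    j = "\<lambda>n. \<lambda>i\<in>{1..r - 1}. n (i + 1)" and
    i = "\<lambda>m. \<lambda>i\<in>{1..r}. if i = 1 then m 1 else m (i - 1)"], goal_cases)
  case (1 n)
  then show ?case
    using assms by (auto simp: fun_eq_iff PiE_iff extensional_def numeral_2_eq_2)
next
  case (2 n)
  then show ?case
    using assms by (auto simp: decreasing_tuples_def PiE_iff monotone_on_def)
next
  case (3 m)
  then show ?case
    using assms by (auto simp: decreasing_tuples_def fun_eq_iff PiE_iff extensional_def)
next
  case (4 m)
  then have pos: "m i > 0" and less: "j \<in> {1..r - 1} \<Longrightarrow> i < j \<Longrightarrow> m j < m i"
    if "i \<in> {1..r - 1}" for i j
    using that by (auto intro: decreasing_tuples_pos decreasing_tuples_less)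
  show ?case
    using assms by (auto simp: PiE_iff monotone_on_def intro!: pos less)
next
  case (5 n)
  then have "n 2 > 0" "n 1 = n 2" using assms by (auto simp: PiE_iff)
  with assms show ?case by (simp add: L_term_merge)
qed

text \<open>The character gives f_1(1) f_1(n_1 - 1) = f_1(n_1), and n_1 - 1 = n_1 (1 - 1/n_1)
  accounts for the power.\<close>

lemma L_term_decrement:
  assumes "r \<ge> 2" "additive_character (f 1)" and n: "n \<in> decreasing_tuples r"
  shows "f 1 1 * L_term r f s (n(1 := n 1 - 1))
    = L_term r f s n * (1 - 1 / of_nat (n 1)) powr (- s 1)"
proof -
  have split: "(\<Prod>i=1..r. g i) = g 1 * (\<Prod>i=2..r. g i)" for g :: "nat \<Rightarrow> complex"
  proof -
    have "{1..r} = insert 1 {2..r}" using assms(1) by auto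
    then show ?thesis by simp
  qed
  have tail: "(\<Prod>i=2..r. g i ((n(1 := n 1 - 1)) i)) = (\<Prod>i=2..r. g i (n i))"
    for g :: "nat \<Rightarrow> nat \<Rightarrow> complex"
    by (intro prod.cong) auto
  have "n 2 < n 1" "n 2 > 0"
    using n assms(1) by (auto intro: decreasing_tuples_less decreasing_tuples_pos)
  then obtain m where m: "n 1 = Suc m" "m > 0"
    by (metis Suc_lessE less_trans_Suc)
  have f: "f 1 1 * f 1 (int m) = f 1 (int (Suc m))"
    using assms(2) by (simp add: additive_character_power del: of_nat_Suc)
  define p :: complex where "p = of_nat (Suc m)"
  have p: "p \<noteq> 0" unfolding p_def by (simp del: of_nat_Suc)
  have eq: "of_nat m = (1 - 1 / p) * p" using p by (simp add: field_simps p_def)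
  have r1: "1 - 1 / p = of_real (real m / real (Suc m))"
    using p by (simp add: p_def field_simps)
  \<comment> \<open>Complex \<open>powr\<close> is multiplicative here because both bases are
    nonnegative reals.\<close>
  have "of_nat m powr s 1 = (1 - 1 / p) powr s 1 * p powr s 1"
    unfolding eq by (rule powr_times_real) (auto simp: r1 p_def)
  moreover have "(1 - 1 / p) powr s 1 \<noteq> 0"
    unfolding r1 using m by (simp del: of_nat_Suc)
  moreover have "(of_nat (n 1) :: complex) = p" "n 1 - 1 = m"
    using m by (simp_all add: p_def)
  ultimately show ?thesis
    unfolding L_term_def split tail[of "\<lambda>i m. f i (int m)"] tail[of "\<lambda>i m. of_nat m powr s i"]
    using p m f by (simp add: powr_minus divide_inverse mult_ac del: of_nat_Suc)
qed

section \<open>Majorant of the double series\<close>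

text \<open>Bounds the summand at \<open>(k, n)\<close> of the right-hand side for all
  \<open>s\<close> obeying the bounds of \<open>compact_bounds\<close>; being free of
  \<open>s\<close>, it controls sup-norms.\<close>

definition dominating_term :: "nat \<Rightarrow> real \<Rightarrow> real \<Rightarrow> nat \<Rightarrow> (nat \<Rightarrow> nat) \<Rightarrow> real" where
  "dominating_term r \<delta> M k n = pochhammer M (k + 1) / fact (k + 1) * (1 / real (n 1)) ^ (k + 1) *
     (\<Prod>i=1..r. real (n i) powr - (1 + \<delta>))"

lemma decreasing_tuples_head_ge_2:
  assumes "r \<ge> 2" "n \<in> decreasing_tuples r"
  shows "n 1 \<ge> 2"
  using decreasing_tuples_less[OF assms(2), of 1 2] decreasing_tuples_pos[OF assms(2), of 2]
    assms(1) by simp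

text \<open>Summing over \<open>k\<close> first gives \<open>(1 - 1 / n 1) powr - M - 1\<close>, which is bounded because
  \<open>n 1 \<ge> 2\<close>.\<close>
lemma summable_on_dominating_term:
  assumes "r \<ge> 2" "\<delta> > 0" "M > 0"
  shows "(\<lambda>(k, n). dominating_term r \<delta> M k n) summable_on UNIV \<times> decreasing_tuples r"
proof -
  let ?P = "\<lambda>n. \<Prod>i=1..r. real (n i) powr - (1 + \<delta>)"
  let ?g = "\<lambda>n::nat \<Rightarrow> nat. ((1 - 1 / real (n 1)) powr (- M) - 1) * ?P n"
  have P0: "?P n \<ge> 0" for n by (intro prod_nonneg) auto
  have nonneg: "dominating_term r \<delta> M k n \<ge> 0" for k n
    unfolding dominating_term_def using assms(3) P0[of n]
    by (intro mult_nonneg_nonneg divide_nonneg_nonneg pochhammer_pos[THEN less_imp_le]) auto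
  have "(\<lambda>(n, k). dominating_term r \<delta> M k n) summable_on decreasing_tuples r \<times> UNIV"
  proof (rule summable_on_SigmaI[where g = ?g])
    fix n assume "n \<in> decreasing_tuples r"
    then have "n 1 \<ge> 2" using decreasing_tuples_head_ge_2[OF assms(1)] by simp
    then have "(\<lambda>k. dominating_term r \<delta> M k n) sums ?g n"
      unfolding dominating_term_def by (intro sums_mult2 real_translation_sums)
    then show "((\<lambda>k. case (n, k) of (n, k) \<Rightarrow> dominating_term r \<delta> M k n) has_sum ?g n) UNIV"
      using nonneg by (auto intro!: sums_nonneg_imp_has_sum)
  next
    have "(\<lambda>n. ((1 / 2) powr (- M)) * ?P n) summable_on decreasing_tuples r"
      using summable_on_prod_powr[OF assms(2)] by (rule summable_on_cmult_right)
    then show "?g summable_on decreasing_tuples r"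
    proof (rule summable_on_comparison_test)
      fix n assume "n \<in> decreasing_tuples r"
      then have "n 1 \<ge> 2" using decreasing_tuples_head_ge_2[OF assms(1)] by simp
      then have x: "1 / 2 \<le> 1 - 1 / real (n 1)" "1 - 1 / real (n 1) \<le> 1"
        by (simp_all add: field_simps)
      then have "(1 - 1 / real (n 1)) powr (- M) \<le> (1 / 2) powr (- M)"
        "1 powr (- M) \<le> (1 - 1 / real (n 1)) powr (- M)"
        using assms(3) by (intro powr_mono2'; simp)+
      with P0[of n] show "?g n \<le> (1 / 2) powr (- M) * ?P n" "0 \<le> ?g n"
        by (auto intro!: mult_right_mono mult_nonneg_nonneg)
    qed
  qed (use nonneg in auto)
  then show ?thesis
    by (subst summable_on_swap) simp
qed

section \<open>Normal convergence and the translation formula\<close>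

theorem theorem2p6:
  fixes r :: nat and f :: "nat \<Rightarrow> int \<Rightarrow> complex"
  assumes "r \<ge> 2"
    and "\<forall>i\<in>{1..r}. additive_character (f i)"
    and "\<forall>i\<in>{1..r}. norm (partial_prod f i 1) \<le> 1"
    and "f 1 1 \<noteq> 1"
  shows "(\<forall>s\<in>U r.
            (\<lambda>k. translation_coeff (s 1) k * multiple_L r f (s(1 := s 1 + of_nat k + 1)))
            sums (f 1 1 * multiple_L (r - 1) (merge_first_two (partial_prod f 2) f)
                                             (merge_first_two (s 1 + s 2) s)
                  + (f 1 1 - 1) * multiple_L r f s))
       \<and> (\<forall>K. compactin (complex_space r) K \<and> K \<subseteq> U r \<longrightarrow>
            normally_convergent_on K
              (\<lambda>k s. translation_coeff (s 1) k * multiple_L r f (s(1 := s 1 + of_nat k + 1))))"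
proof (intro conjI allI ballI impI)
  let ?D = "decreasing_tuples r"
  let ?F = "\<lambda>s k n. translation_coeff (s 1) k * L_term r f (s(1 := s 1 + of_nat k + 1)) n"
  \<comment> \<open>Collects the dependence on \<open>k\<close>, so that for fixed \<open>n\<close>
    the sum over \<open>k\<close> is a binomial series.\<close>
  have F: "?F s k n = L_term r f s n * (translation_coeff (s 1) k * (1 / of_nat (n 1)) ^ (k + 1))"
    if "n \<in> ?D" for s k n
    using decreasing_tuples_head_ge_2[OF assms(1) that] assms(1) by (subst L_term_shift) auto
  have F_le: "norm (?F s k n) \<le> dominating_term r \<delta> M k n"
    if n: "n \<in> ?D" and s: "norm (s 1) \<le> M"
      "\<forall>i\<in>{1..r}. real i * (1 + \<delta>) \<le> Re (\<Sum>j=1..i. s j)" for s k n \<delta> M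
  proof -
    have "norm (?F s k n)
        = norm (translation_coeff (s 1) k) * (1 / real (n 1)) ^ (k + 1) * norm (L_term r f s n)"
      unfolding F[OF n] by (simp add: norm_mult norm_power norm_divide)
    also have "\<dots> \<le> dominating_term r \<delta> M k n"
      unfolding dominating_term_def using assms(1-3) n s
      by (intro mult_mono norm_translation_coeff_le norm_L_term_le mult_nonneg_nonneg
          order.trans[OF norm_ge_zero norm_translation_coeff_le]) auto
    finally show ?thesis .
  qed
  have summable_dom: "dominating_term r \<delta> M k summable_on ?D" if "\<delta> > 0" "M > 0" for \<delta> M k
    using summable_on_SigmaD1[OF summable_on_dominating_term[OF assms(1) that], of k] by simp

  have F_summable: "?F s k summable_on ?D"
    if "\<delta> > 0" "M > 0" and s: "norm (s 1) \<le> M"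
      "\<forall>i\<in>{1..r}. real i * (1 + \<delta>) \<le> Re (\<Sum>j=1..i. s j)" for s k \<delta> M
    using summable_dom[OF that(1,2), of k] F_le[OF _ s] by (rule summable_on_norm_le)

  {
    fix K assume K: "compactin (complex_space r) K \<and> K \<subseteq> U r"
    then obtain \<delta> M where \<delta>M: "\<delta> > 0" "M > 0" and K_le: "\<And>s. s \<in> K \<Longrightarrow> norm (s 1) \<le> M"
      "\<And>s. s \<in> K \<Longrightarrow> \<forall>i\<in>{1..r}. real i * (1 + \<delta>) \<le> Re (\<Sum>j=1..i. s j)"
      using compact_bounds[of r K] assms(1) by auto
    \<comment> \<open>Summing the majorant over tuples leaves bounds uniform in
      \<open>s \<in> K\<close>; summability of the double majorant makes them summable in
      \<open>k\<close>.\<close>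
    define b where "b k = infsum (dominating_term r \<delta> M k) ?D" for k
    have "b summable_on UNIV"
      unfolding b_def using summable_on_dominating_term[OF assms(1) \<delta>M]
      by (rule summable_on_Sigma_banach)
    then have b: "summable b"
      by (meson has_sum_imp_sums sums_summable summable_on_def)
    have le: "norm (translation_coeff (s 1) k * multiple_L r f (s(1 := s 1 + of_nat k + 1))) \<le> b k"
      if "s \<in> K" for s k
      unfolding multiple_L_eq infsum_cmult_right'[symmetric] b_def
      by (rule norm_infsum_le[OF F_summable[OF \<delta>M K_le[OF that], THEN has_sum_infsum]
            summable_dom[OF \<delta>M, THEN has_sum_infsum] F_le[OF _ K_le[OF that]]])
    show "normally_convergent_on K
        (\<lambda>k s. translation_coeff (s 1) k * multiple_L r f (s(1 := s 1 + of_nat k + 1)))"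
    \<comment> \<open>\<open>b k \<ge> 0\<close> is read off at a point of \<open>K\<close>, so the
      empty set is treated apart; there every supremum is 0.\<close>
    proof (cases "K = {}")
      case True
      then show ?thesis by (simp add: normally_convergent_on_def bot_ennreal)
    next
      case False
      then have b0: "b k \<ge> 0" for k
        using le norm_ge_zero order.trans by blast
      have "(\<Sum>k. SUP s\<in>K. ennreal (norm (translation_coeff (s 1) k
          * multiple_L r f (s(1 := s 1 + of_nat k + 1))))) \<le> (\<Sum>k. ennreal (b k))"
        using le by (intro suminf_le SUP_least ennreal_leI summableI) auto
      also have "\<dots> < \<infinity>"
        using ennreal_suminf_neq_top[OF b b0] by (simp add: less_top)
      finally show ?thesis by (simp add: normally_convergent_on_def)
    qed
  }

  fix s assume s: "s \<in> U r"
  define T where "T = L_term r f s"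
  define E :: "(nat \<Rightarrow> nat) set" where "E = {n \<in> {1..r} \<rightarrow>\<^sub>E {0<..}. n 1 = n 2 \<and> strict_antimono_on {2..r} n}"
  have f1: "additive_character (f 1)" "f 1 1 \<noteq> 0"
    using assms(1,2) by (auto simp: additive_character_def)
  \<comment> \<open>A point is compact, so the uniform bounds also serve the pointwise
    identity.\<close>
  have "compactin (complex_space r) {s}"
    using s by (simp add: U_def)
  then obtain \<delta> M where \<delta>M: "\<delta> > 0" "M > 0" and s_le: "norm (s 1) \<le> M"
    "\<forall>i\<in>{1..r}. real i * (1 + \<delta>) \<le> Re (\<Sum>j=1..i. s j)"
    using compact_bounds[of r "{s}"] s assms(1) by auto
  have T_D: "T summable_on ?D"
    using summable_on_prod_powr[OF \<delta>M(1), of r]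
    by (rule summable_on_norm_le)
      (use norm_L_term_le[OF _ assms(2,3) s_le(2)] assms(1) in \<open>auto simp: T_def\<close>)
  have "(\<lambda>(k, n). ?F s k n) summable_on UNIV \<times> ?D"
    using summable_on_dominating_term[OF assms(1) \<delta>M]
    by (rule summable_on_norm_le) (use F_le[OF _ s_le] in auto)
  \<comment> \<open>Summing over \<open>n\<close> first gives the series of the theorem, summing
    over \<open>k\<close> first gives the closed form \<open>?G\<close>; both have the sum
    \<open>S\<close>.\<close>
  then obtain S where S: "((\<lambda>(k, n). ?F s k n) has_sum S) (UNIV \<times> ?D)"
    by (auto simp: summable_on_def)
  have "((\<lambda>k. infsum (?F s k) ?D) has_sum S) UNIV"
    by (rule has_sum_SigmaD[OF S]) (use F_summable[OF \<delta>M s_le] in auto)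
  then have lhs: "(\<lambda>k. translation_coeff (s 1) k * multiple_L r f (s(1 := s 1 + of_nat k + 1))) sums S"
    unfolding multiple_L_eq infsum_cmult_right' by (rule has_sum_imp_sums)
  let ?G = "\<lambda>n. T n * ((1 - 1 / of_nat (n 1)) powr (- s 1) - 1)"
  have "(?G has_sum S) ?D"
  proof (rule has_sum_SigmaD)
    show "((\<lambda>(n, k). ?F s k n) has_sum S) (?D \<times> UNIV)"
      using S by (subst has_sum_swap) simp
    fix n assume n: "n \<in> ?D"
    \<comment> \<open>Absolute convergence in \<open>k\<close> turns the ordered binomial series
      into an unordered sum.\<close>
    have "summable (\<lambda>k. dominating_term r \<delta> M k n)"
      unfolding dominating_term_def
      by (intro summable_mult2 sums_summable[OF real_translation_sums]
          decreasing_tuples_head_ge_2[OF assms(1) n])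
    then have "summable (\<lambda>k. norm (?F s k n))"
      by (rule summable_comparison_test'[of _ 0]) (use F_le[OF n s_le] in auto)
    moreover have "(\<lambda>k. ?F s k n) sums ?G n"
      unfolding F[OF n] T_def
      by (intro sums_mult complex_translation_sums decreasing_tuples_head_ge_2[OF assms(1) n])
    ultimately show "((\<lambda>k. case (n, k) of (n, k) \<Rightarrow> ?F s k n) has_sum ?G n) UNIV"
      by (simp add: norm_summable_imp_has_sum)
  qed
  \<comment> \<open>Adding \<open>T n\<close> cancels the \<open>- 1\<close> in \<open>?G\<close>;
    what remains is \<open>f 1 1\<close> times the summand at the decremented tuple.\<close>
  then have "((\<lambda>n. ?G n + T n) has_sum (S + infsum T ?D)) ?D"
    using T_D by (intro has_sum_add) auto
  then have dec: "((\<lambda>n. f 1 1 * T (n(1 := n 1 - 1))) has_sum (S + infsum T ?D)) ?D"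
  proof (rule has_sum_cong[THEN iffD1, rotated])
    show "?G n + T n = f 1 1 * T (n(1 := n 1 - 1))" if "n \<in> ?D" for n
      unfolding T_def L_term_decrement[OF assms(1), of f, OF f1(1) that]
      by (simp add: algebra_simps)
  qed
  have T_shift: "(\<lambda>n. T (n(1 := n 1 - 1))) summable_on ?D"
    using has_sum_imp_summable[OF dec] f1(2) by (simp add: summable_on_cmult_right')
  \<comment> \<open>Since n_2 < n_1 means n_2 <= n_1 - 1, decrementing maps \<open>?D\<close>
    bijectively onto \<open>?D \<union> E\<close>; the new first entry stays positive because
    \<open>n 1 \<ge> 2\<close>.\<close>
  have wit: "(n(1 := n 1 - 1))(1 := (n(1 := n 1 - 1)) 1 + 1) = n" "n(1 := n 1 - 1) \<in> ?D \<union> E"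
    if "n \<in> ?D" for n
    using that decreasing_tuples_head_ge_2[OF assms(1) that] assms(1)
    by (auto simp: decreasing_tuples_iff E_def PiE_iff extensional_def monotone_on_def)
  have wit': "(n(1 := n 1 + 1))(1 := (n(1 := n 1 + 1)) 1 - 1) = n" "n(1 := n 1 + 1) \<in> ?D"
    if "n \<in> ?D \<union> E" for n
    using that assms(1)
    by (auto simp: decreasing_tuples_iff E_def PiE_iff extensional_def monotone_on_def)
  have "infsum (\<lambda>n. T (n(1 := n 1 - 1))) ?D = infsum T (?D \<union> E)"
    by (rule infsum_reindex_bij_witness[OF wit wit' refl])
  \<comment> \<open>Reindexing transports summability of the shifted family to the union, hence to
    the diagonal, so the sum splits.\<close>
  moreover have "T summable_on ?D \<union> E"
    by (rule iffD1[OF summable_on_reindex_bij_witness[OF wit wit' refl] T_shift])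
  then have "T summable_on E"
    by (rule summable_on_subset) auto
  then have "infsum T (?D \<union> E) = infsum T ?D + infsum T E"
    using T_D assms(1) by (intro infsum_Un_disjoint) (auto simp: decreasing_tuples_iff E_def)
  ultimately have "f 1 1 * (infsum T ?D + infsum T E) = S + infsum T ?D"
    using infsumI[OF dec] by (simp add: infsum_cmult_right')
  then have "S = f 1 1 * infsum T E + (f 1 1 - 1) * infsum T ?D"
    by (simp add: algebra_simps)
  with lhs show "(\<lambda>k. translation_coeff (s 1) k * multiple_L r f (s(1 := s 1 + of_nat k + 1)))
      sums (f 1 1 * multiple_L (r - 1) (merge_first_two (partial_prod f 2) f)
                                       (merge_first_two (s 1 + s 2) s)
            + (f 1 1 - 1) * multiple_L r f s)"
    unfolding T_def E_def infsum_merge[OF assms(1)] multiple_L_eq[of r, symmetric] by simp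
qed

end
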